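(* Let $d,n,m\in\mathbb{N}$, let $\alpha=(\alpha_j)_{j\in\mathbb{I}_m}\in\mathbb{R}_{\ge 0}^m$ be non-increasing, and let $A\in\mathcal{M}_d(\mathbb{C})$ be positive semidefinite. Then there exists $\mathcal{F}^{\rm op}=\{T_j^{\rm op}\}_{j\in\mathbb{I}_m}\in\Lambda_\alpha$ such that $$\|A-S_{\mathcal{F}^{\rm op}}\|_2\le\|A-S_{\mathcal{F}}\|_2\quad\text{for all }\mathcal{F}\in\Lambda_\alpha.$$ Moreover, the minimal distance and the approximants are those of the classical approximation problem with initial data the spectrum of $A$ and the weights $w=\big(\frac{\alpha_1}{n}\mathbf{1}_n,\frac{\alpha_2}{n}\mathbf{1}_n,\dots,\frac{\alpha_m}{n}\mathbf{1}_n\big)\in\mathbb{R}^{nm}$: that is, $$\min_{\mathcal{F}\in\Lambda_\alpha}\|A-S_{\mathcal{F}}\|_2=\min_{\mathcal{G}\in\mathcal{B}_{w,d}}\|A-S_{\mathcal{G}}\|_2,$$ this value depends on $A$ only through its spectrum (with multiplicities), and $\mathcal{F}\in\Lambda_\alpha$ attains the minimum on the left if and only if $S_{\mathcal{F}}=S_{\mathcal{G}}$ for some $\mathcal{G}\in\mathcal{B}_{w,d}$ attaining the minimum on the right.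
   Context: $\mathbb{I}_m=\{1,\dots,m\}$; $\mathbf{1}_n\in\mathbb{R}^n$ is the all-ones vector; $\|\cdot\|_2$ is the Frobenius norm, $\|T\|_2^2=\operatorname{tr}(T^*T)$. A (finite) G-Bessel sequence for $\mathbb{C}^d$ with analysis space $\mathbb{C}^n$ is a family $\mathcal{F}=\{T_i\}_{i\in\mathbb{I}_m}$ of linear operators $T_i:\mathbb{C}^d\to\mathbb{C}^n$ for which there is $b>0$ with $\sum_i\|T_ix\|^2\le b\|x\|^2$ for all $x\in\mathbb{C}^d$ (automatic here). Its frame operator is $S_{\mathcal{F}}=\sum_{i\in\mathbb{I}_m}T_i^*T_i$. The set $\Lambda_\alpha$ consists of all such $\mathcal{F}=\{T_i\}_{i\in\mathbb{I}_m}$ with $\|T_i\|_2^2=\alpha_i$ for $i\in\mathbb{I}_m$. Classical approximation problem: for weights $w=(w_i)_{i\in\mathbb{I}_N}$, $w_i\ge 0$, let $\mathcal{B}_{w,d}=\{\mathcal{G}=\{g_i\}_{i\in\mathbb{I}_N}\in(\mathbb{C}^d)^N:\ \|g_i\|^2=w_i,\ i\in\mathbb{I}_N\}$, and for $\mathcal{G}\in\mathcal{B}_{w,d}$ let $S_{\mathcal{G}}=\sum_{i\in\mathbb{I}_N}g_i\otimes g_i$, where $(g\otimes g)z=\langle z,g\rangle g$. The problem is to minimize $\|A-S_{\mathcal{G}}\|_2$ over $\mathcal{G}\in\mathcal{B}_{w,d}$. *)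

theory Defs
  imports "HOL-Analysis.Analysis" "HOL-Computational_Algebra.Polynomial"
begin

text \<open>
  Operators from complex d-space to complex n-space are represented by their matrices
  \<^typ>\<open>complex^'d^'n\<close> in the standard bases; the dimensions are \<open>CARD('d)\<close> and \<open>CARD('n)\<close>.
  A family indexed by \<open>1,\<dots>,m\<close> is a function on \<^typ>\<open>nat\<close> of which only the values on \<open>{1..m}\<close>
  matter. The vector norm is the library norm on \<^typ>\<open>complex^'d\<close>, which is the Euclidean one;
  the library inner product on that type is only the real part of \<open>hinner\<close>.
\<close>

definition hinner :: "complex^'d \<Rightarrow> complex^'d \<Rightarrow> complex" where
  "hinner x y = (\<Sum>i\<in>UNIV. x $ i * cnj (y $ i))"

definition ctranspose :: "complex^'d^'n \<Rightarrow> complex^'n^'d" where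
  "ctranspose T = (\<chi> i j. cnj (T $ j $ i))"

definition frob_norm :: "complex^'d^'n \<Rightarrow> real" where
  "frob_norm T = sqrt (Re (trace (ctranspose T ** T)))"

definition pos_semidef :: "complex^'d^'d \<Rightarrow> bool" where
  "pos_semidef A \<longleftrightarrow> ctranspose A = A \<and> (\<forall>x. Re (hinner (A *v x) x) \<ge> 0)"

definition charpoly :: "complex^'d^'d \<Rightarrow> complex poly" where
  "charpoly A = det (\<chi> i j. (if i = j then [:0, 1:] else 0) - [:A $ i $ j:])"

definition spectrum :: "complex^'d^'d \<Rightarrow> complex multiset" where
  "spectrum A = proots (charpoly A)"

definition G_bessel :: "nat \<Rightarrow> (nat \<Rightarrow> complex^'d^'n) \<Rightarrow> bool" where
  "G_bessel m T \<longleftrightarrow> (\<exists>b>0. \<forall>x. (\<Sum>i\<in>{1..m}. (norm (T i *v x))\<^sup>2) \<le> b * (norm x)\<^sup>2)"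

definition G_frame_operator :: "nat \<Rightarrow> (nat \<Rightarrow> complex^'d^'n) \<Rightarrow> complex^'d^'d" where
  "G_frame_operator m T = (\<Sum>i\<in>{1..m}. ctranspose (T i) ** T i)"

definition \<Lambda> :: "nat \<Rightarrow> (nat \<Rightarrow> real) \<Rightarrow> (nat \<Rightarrow> complex^'d^'n) set" where
  "\<Lambda> m \<alpha> = {T. G_bessel m T \<and> (\<forall>i\<in>{1..m}. (frob_norm (T i))\<^sup>2 = \<alpha> i)}"

definition rank_one :: "complex^'d \<Rightarrow> complex^'d^'d" where
  "rank_one g = matrix (\<lambda>z. hinner z g *s g)"

definition frame_operator :: "nat \<Rightarrow> (nat \<Rightarrow> complex^'d) \<Rightarrow> complex^'d^'d" where
  "frame_operator N g = (\<Sum>i\<in>{1..N}. rank_one (g i))"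

definition \<B> :: "nat \<Rightarrow> (nat \<Rightarrow> real) \<Rightarrow> (nat \<Rightarrow> complex^'d) set" where
  "\<B> N w = {g. \<forall>i\<in>{1..N}. (norm (g i))\<^sup>2 = w i}"

text \<open>
  The weights \<open>(\<alpha>\<^sub>1/n, \<dots>, \<alpha>\<^sub>1/n, \<alpha>\<^sub>2/n, \<dots>, \<alpha>\<^sub>m/n)\<close>, each value repeated \<open>n\<close> times:
  position \<open>i\<close>, counted from 1, lies in block \<open>(i - 1) div n + 1\<close>.
\<close>

definition block_weights :: "nat \<Rightarrow> (nat \<Rightarrow> real) \<Rightarrow> nat \<Rightarrow> real" where
  "block_weights n \<alpha> i = \<alpha> ((i - 1) div n + 1) / real n"

end

theory Submission
  imports Defs "HOL-Combinatorics.Permutations"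
begin

text \<open>
  Every list of \<open>n\<close> vectors can be rotated, two vectors at a time and without changing the sum of the
  rank-one operators, until all norms agree. Applied to the conjugated rows of each \<open>T\<^sub>j\<close> this shows that
  the frame operators of \<open>\<Lambda>\<close> and those of \<open>\<B>\<close> form the same set, which is compact. As this set is
  invariant under unitary conjugation, the minimum depends only on the unitary orbit of \<open>A\<close>, and
  a Hermitian matrix is determined up to unitary conjugation by its spectrum.
\<close>

section \<open>Matrix algebra and the Frobenius norm\<close>

lemma ctranspose_ctranspose [simp]: "ctranspose (ctranspose T) = T"
  by (simp add: ctranspose_def vec_eq_iff)

lemma ctranspose_mult: "ctranspose (S ** T) = ctranspose T ** ctranspose S"
  by (simp add: ctranspose_def matrix_matrix_mult_def vec_eq_iff mult.commute)

lemma matrix_add_rdistrib: "(A + B) ** C = A ** C + B ** C"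
  for A B :: "'a::semiring_1^'n^'m"
  by (simp add: matrix_matrix_mult_def vec_eq_iff distrib_right sum.distrib)

lemma matrix_sub_ldistrib: "A ** (B - C) = A ** B - A ** C"
  for A :: "'a::ring_1^'n^'m"
  by (simp add: matrix_matrix_mult_def vec_eq_iff right_diff_distrib sum_subtractf)

lemma matrix_sub_rdistrib: "(A - B) ** C = A ** C - B ** C"
  for A B :: "'a::ring_1^'n^'m"
  by (simp add: matrix_matrix_mult_def vec_eq_iff left_diff_distrib sum_subtractf)

text \<open>The trace adds the squared moduli column by column, the library norm row by row. The
  identification opens library facts on continuity and compactness to
  \<open>frob_norm\<close>.\<close>

lemma frob_norm_eq_norm: "frob_norm T = norm T"
proof -
  have "Re (trace (ctranspose T ** T)) = (\<Sum>j\<in>UNIV. \<Sum>i\<in>UNIV. (norm (T $ i $ j))\<^sup>2)"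
    by (simp add: trace_def ctranspose_def matrix_matrix_mult_def cmod_power2)
      (simp add: power2_eq_square)
  also have "\<dots> = (\<Sum>i\<in>UNIV. \<Sum>j\<in>UNIV. (norm (T $ i $ j))\<^sup>2)"
    by (rule sum.swap)
  also have "\<dots> = (norm T)\<^sup>2"
    by (simp add: norm_vec_def L2_set_def sum_nonneg)
  finally show ?thesis
    by (simp add: frob_norm_def)
qed

lemma rank_one_nth: "rank_one g $ a $ b = g $ a * cnj (g $ b)"
proof -
  have "hinner (axis b 1) g = cnj (g $ b)"
    by (simp add: hinner_def axis_def if_distrib[of "\<lambda>x. x * _"] cong: if_cong)
  then show ?thesis
    by (simp add: rank_one_def matrix_def)
qed

text \<open>Linear maps between finite-dimensional spaces are bounded, so membership in
  \<open>\<Lambda>\<close> reduces to the conditions on the Frobenius norms.\<close>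

lemma G_bessel: "G_bessel m T"
proof -
  have "\<exists>c. \<forall>x. norm (T i *v x) \<le> norm x * c" for i
  proof -
    have "linear ((*v) (T i))"
      by (intro linearI vec_eq_iff[THEN iffD2] allI)
        (auto simp: matrix_vector_mult_def algebra_simps sum.distrib scaleR_sum_right)
    then show ?thesis
      using bounded_linear.bounded linear_conv_bounded_linear by blast
  qed
  then obtain c where c: "norm (T i *v x) \<le> norm x * c i" for i x
    by metis
  \<comment> \<open>The summand 1 keeps the Bessel bound strictly positive even when all
    \<open>c i\<close> vanish.\<close>
  have "(\<Sum>i\<in>{1..m}. (norm (T i *v x))\<^sup>2) \<le> (1 + (\<Sum>i\<in>{1..m}. (c i)\<^sup>2)) * (norm x)\<^sup>2" for x
  proof -
    have "(\<Sum>i\<in>{1..m}. (norm (T i *v x))\<^sup>2) \<le> (\<Sum>i\<in>{1..m}. (norm x * c i)\<^sup>2)"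
      by (intro sum_mono power_mono c) auto
    also have "\<dots> = (\<Sum>i\<in>{1..m}. (c i)\<^sup>2) * (norm x)\<^sup>2"
      by (simp add: power_mult_distrib sum_distrib_left mult.commute)
    finally show ?thesis
      by (simp add: distrib_right add_increasing)
  qed
  moreover have "0 < 1 + (\<Sum>i\<in>{1..m}. (c i)\<^sup>2)"
    by (simp add: add_pos_nonneg sum_nonneg)
  ultimately show ?thesis
    unfolding G_bessel_def by blast
qed

subsection \<open>Equalizing norms\<close>

text \<open>The coefficients are real, so complex conjugation leaves them alone and the mixed terms
  of the two summands cancel.\<close>

lemma rank_one_rotate:
  fixes x y :: "complex^'d"
  assumes "c\<^sup>2 + s\<^sup>2 = (1::real)"
  shows "rank_one (c *\<^sub>R x + s *\<^sub>R y) + rank_one (c *\<^sub>R y - s *\<^sub>R x) = rank_one x + rank_one y"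
proof -
  have "rank_one (c *\<^sub>R x + s *\<^sub>R y) $ a $ b + rank_one (c *\<^sub>R y - s *\<^sub>R x) $ a $ b
     = (complex_of_real (c\<^sup>2 + s\<^sup>2)) * (rank_one x $ a $ b + rank_one y $ a $ b)" for a b
    by (simp add: rank_one_nth) (simp add: scaleR_conv_of_real algebra_simps power2_eq_square)
  then show ?thesis
    using assms by (simp add: vec_eq_iff)
qed

text \<open>The mixed inner products cancel. Hence a rotation of two vectors preserves the total
  squared norm assumed in \<open>equalize_norms\<close>.\<close>

lemma norm_rotate:
  fixes x y :: "'a::real_inner"
  assumes "c\<^sup>2 + s\<^sup>2 = (1::real)"
  shows "(norm (c *\<^sub>R x + s *\<^sub>R y))\<^sup>2 + (norm (c *\<^sub>R y - s *\<^sub>R x))\<^sup>2 = (norm x)\<^sup>2 + (norm y)\<^sup>2"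
proof -
  have "(norm (c *\<^sub>R x + s *\<^sub>R y))\<^sup>2 + (norm (c *\<^sub>R y - s *\<^sub>R x))\<^sup>2
      = (c\<^sup>2 + s\<^sup>2) * ((norm x)\<^sup>2 + (norm y)\<^sup>2)"
    unfolding power2_norm_eq_inner
    by (simp add: inner_diff_left inner_diff_right inner_add_left inner_add_right inner_commute)
      (simp add: algebra_simps power2_eq_square)
  then show ?thesis
    using assms by simp
qed

text \<open>Along the quarter circle from angle 0 to \<open>pi / 2\<close> the vector moves
  continuously from \<open>x\<close> to \<open>y\<close>, so the intermediate value theorem
  applies.\<close>

lemma exists_rotation_norm:
  fixes x y :: "'a::real_inner"
  assumes "(norm x)\<^sup>2 \<le> \<beta>" "\<beta> \<le> (norm y)\<^sup>2"
  obtains c s :: real where "c\<^sup>2 + s\<^sup>2 = 1" "(norm (c *\<^sub>R x + s *\<^sub>R y))\<^sup>2 = \<beta>"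
proof -
  define f where "f t = (norm (cos t *\<^sub>R x + sin t *\<^sub>R y))\<^sup>2" for t
  have "\<exists>t. 0 \<le> t \<and> t \<le> pi / 2 \<and> f t = \<beta>"
  proof (rule IVT')
    show "continuous_on {0..pi / 2} f"
      unfolding f_def by (intro continuous_intros)
  qed (use assms in \<open>auto simp: f_def\<close>)
  then obtain t where "f t = \<beta>"
    by blast
  then show ?thesis
    using that[of "cos t" "sin t"] by (simp add: f_def)
qed

text \<open>Induction on the number of indices whose squared norm differs from \<beta>. Since
  \<beta> is the average, a deviation in one direction forces one in the other, and rotating such a
  pair repairs one of its two vectors.\<close>

lemma equalize_norms:
  fixes g :: "'i \<Rightarrow> complex^'d"
  assumes "finite I" "(\<Sum>i\<in>I. (norm (g i))\<^sup>2) = real (card I) * \<beta>"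
  shows "\<exists>g'. (\<Sum>i\<in>I. rank_one (g' i)) = (\<Sum>i\<in>I. rank_one (g i)) \<and> (\<forall>i\<in>I. (norm (g' i))\<^sup>2 = \<beta>)"
  using assms
proof (induction "card {i\<in>I. (norm (g i))\<^sup>2 \<noteq> \<beta>}" arbitrary: g rule: less_induct)
  case less
  show ?case
  proof (cases "\<forall>i\<in>I. (norm (g i))\<^sup>2 = \<beta>")
    case False
    have sum0: "(\<Sum>i\<in>I. (norm (g i))\<^sup>2 - \<beta>) = 0"
      using less.prems by (simp add: sum_subtractf)
    have "\<exists>i\<in>I. (norm (g i))\<^sup>2 < \<beta>"
    proof (rule ccontr)
      assume "\<not> ?thesis"
      then have "\<forall>i\<in>I. (norm (g i))\<^sup>2 - \<beta> = 0"
        using sum0 sum_nonneg_eq_0_iff[OF less.prems(1), of "\<lambda>i. (norm (g i))\<^sup>2 - \<beta>"] by force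
      with False show False by auto
    qed
    moreover have "\<exists>j\<in>I. \<beta> < (norm (g j))\<^sup>2"
    proof (rule ccontr)
      assume "\<not> ?thesis"
      moreover have "(\<Sum>i\<in>I. \<beta> - (norm (g i))\<^sup>2) = 0"
        using less.prems by (simp add: sum_subtractf)
      ultimately have "\<forall>i\<in>I. \<beta> - (norm (g i))\<^sup>2 = 0"
        using sum_nonneg_eq_0_iff[OF less.prems(1), of "\<lambda>i. \<beta> - (norm (g i))\<^sup>2"] by force
      with False show False by auto
    qed
    ultimately obtain i j where ij: "i \<in> I" "j \<in> I" "(norm (g i))\<^sup>2 < \<beta>" "\<beta> < (norm (g j))\<^sup>2"
      by blast
    then have "i \<noteq> j" by auto
    obtain c s where cs: "c\<^sup>2 + s\<^sup>2 = 1" "(norm (c *\<^sub>R g i + s *\<^sub>R g j))\<^sup>2 = \<beta>"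
      using exists_rotation_norm[of "g i" \<beta> "g j"] ij by auto
    \<comment> \<open>Index \<open>i\<close> reaches the target \<beta>, and \<open>j\<close>
      absorbs the difference.\<close>
    define h where "h = g(i := c *\<^sub>R g i + s *\<^sub>R g j, j := c *\<^sub>R g j - s *\<^sub>R g i)"
    have split: "sum F I = F i + F j + sum F (I - {i, j})" for F :: "'i \<Rightarrow> 'b::comm_monoid_add"
      using sum.subset_diff[of "{i, j}" I F] ij \<open>i \<noteq> j\<close> less.prems(1)
      by (simp add: add.commute)
    have h_rest: "(\<Sum>k\<in>I - {i, j}. F (h k)) = (\<Sum>k\<in>I - {i, j}. F (g k))" for F :: "_ \<Rightarrow> 'b::comm_monoid_add"
      by (intro sum.cong) (auto simp: h_def)
    have ro: "(\<Sum>k\<in>I. rank_one (h k)) = (\<Sum>k\<in>I. rank_one (g k))"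
      using rank_one_rotate[OF cs(1)] h_rest[of rank_one] \<open>i \<noteq> j\<close> by (simp add: split h_def)
    have "(\<Sum>k\<in>I. (norm (h k))\<^sup>2) = (\<Sum>k\<in>I. (norm (g k))\<^sup>2)"
      using norm_rotate[OF cs(1), of "g i" "g j"] h_rest[of "\<lambda>v. (norm v)\<^sup>2"] \<open>i \<noteq> j\<close>
      by (simp add: split h_def)
    \<comment> \<open>Index \<open>i\<close> leaves the set; \<open>j\<close> already belonged to
      it, so the new norm at \<open>j\<close> cannot enlarge it.\<close>
    moreover have "{k\<in>I. (norm (h k))\<^sup>2 \<noteq> \<beta>} \<subset> {k\<in>I. (norm (g k))\<^sup>2 \<noteq> \<beta>}" (is "?L \<subset> ?R")
    proof -
      have "(norm (h i))\<^sup>2 = \<beta>"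
        using cs(2) \<open>i \<noteq> j\<close> by (simp add: h_def)
      moreover have "h k = g k" if "k \<noteq> i" "k \<noteq> j" for k
        using that by (simp add: h_def)
      ultimately have "k \<in> ?R - {i}" if "k \<in> ?L" for k
        using that ij(2,4) by (cases "k = i"; cases "k = j") auto
      moreover have "i \<in> ?R"
        using ij by simp
      ultimately show ?thesis by blast
    qed
    then have "card {k\<in>I. (norm (h k))\<^sup>2 \<noteq> \<beta>} < card {k\<in>I. (norm (g k))\<^sup>2 \<noteq> \<beta>}"
      by (intro psubset_card_mono) (use less.prems in auto)
    ultimately show ?thesis
      using less.hyps[of h] less.prems ro by auto
  qed auto
qed

subsection \<open>The set of frame operators\<close>

text \<open>The bridge between operators and vectors: row \<open>k\<close> contributes
  \<open>cnj (T $ k $ a) * T $ k $ b\<close> to entry \<open>(a, b)\<close>, which is a rank-one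
  operator of the conjugated row.\<close>

lemma ctranspose_mult_self_rows:
  fixes T :: "complex^'d^'n"
  shows "ctranspose T ** T = (\<Sum>k\<in>UNIV. rank_one (\<chi> a. cnj (T $ k $ a)))"
  by (simp add: vec_eq_iff rank_one_nth ctranspose_def matrix_matrix_mult_def)

lemma frob_norm_rows:
  fixes T :: "complex^'d^'n"
  shows "(frob_norm T)\<^sup>2 = (\<Sum>k\<in>UNIV. (norm (\<chi> a. cnj (T $ k $ a)))\<^sup>2)"
  by (simp add: frob_norm_eq_norm norm_vec_def L2_set_def sum_nonneg)

lemma sum_blocks:
  fixes f :: "nat \<Rightarrow> 'a::comm_monoid_add"
  shows "(\<Sum>i\<in>{1..n * m}. f i) = (\<Sum>j\<in>{1..m}. \<Sum>k<n. f ((j - 1) * n + k + 1))"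
proof -
  have "(\<Sum>i\<in>{1..n * m}. f i) = (\<Sum>i<m * n. f (Suc i))"
    by (simp add: sum.atLeast1_atMost_eq mult.commute)
  also have "\<dots> = (\<Sum>j<m. \<Sum>k<n. f (Suc (j * n + k)))"
    \<comment> \<open>Grouping gives the intervals \<open>{j * n..<j * n + n}\<close>; the shift
      rule re-indexes each of them from 0.\<close>
    unfolding sum.nat_group[of "\<lambda>i. f (Suc i)" n m, symmetric]
    using sum.shift_bounds_nat_ivl[of "\<lambda>i. f (Suc i)" 0 "_ * n" n]
    by (simp add: lessThan_atLeast0 add.commute)
  also have "\<dots> = (\<Sum>j\<in>{1..m}. \<Sum>k<n. f ((j - 1) * n + k + 1))"
    by (simp add: sum.atLeast1_atMost_eq)
  finally show ?thesis .
qed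

lemma block_weights_block:
  assumes "k < n" "1 \<le> j"
  shows "block_weights n \<alpha> ((j - 1) * n + k + 1) = \<alpha> j / real n"
  using assms by (simp add: block_weights_def)

text \<open>Division of \<open>i - 1\<close> by \<open>n\<close> with remainder: blocks are counted
  from 1, positions inside a block from 0.\<close>

lemma block_index_cases:
  fixes i :: nat
  assumes "i \<in> {1..n * m}"
  obtains j k where "j \<in> {1..m}" "k < n" "i = (j - 1) * n + k + 1"
proof -
  have "n > 0" using assms by (cases n) auto
  moreover have "i - 1 < m * n"
    using assms by (auto simp: mult.commute)
  then have "(i - 1) div n < m"
    by (rule less_mult_imp_div_less)
  moreover have "i = (i - 1) div n * n + (i - 1) mod n + 1"
    using assms by simp
  ultimately show ?thesis
    using that[of "(i - 1) div n + 1" "(i - 1) mod n"] by simp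
qed

text \<open>The conjugated rows of \<open>F j\<close> have total squared norm
  \<open>\<alpha> j\<close>. Equalizing them within each block gives vectors of squared norm
  \<open>\<alpha> j / n\<close> with the same operator sum.\<close>

lemma G_frame_operator_eq_frame_operator:
  fixes F :: "nat \<Rightarrow> complex^'d^'n"
  assumes "F \<in> \<Lambda> m \<alpha>"
  shows "\<exists>G\<in>\<B> (CARD('n) * m) (block_weights CARD('n) \<alpha>).
           frame_operator (CARD('n) * m) G = G_frame_operator m F"
proof -
  let ?n = "CARD('n)"
  \<comment> \<open>An enumeration of the row index type, so that rows correspond to positions
    inside a block.\<close>
  obtain e where e: "bij_betw e {..<?n} (UNIV :: 'n set)"
    using ex_bij_betw_nat_finite[of "UNIV :: 'n set"] by (auto simp: lessThan_atLeast0)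
  have "\<exists>g. ctranspose (F j) ** F j = (\<Sum>k<?n. rank_one (g k)) \<and>
          (\<forall>k<?n. (norm (g k))\<^sup>2 = \<alpha> j / ?n)" if "j \<in> {1..m}" for j
  proof -
    let ?r = "\<lambda>k. (\<chi> a. cnj (F j $ k $ a)) :: complex^'d"
    have "(\<Sum>k<?n. (norm (?r (e k)))\<^sup>2) = (frob_norm (F j))\<^sup>2"
      unfolding frob_norm_rows by (rule sum.reindex_bij_betw[OF e])
    also have "\<dots> = real (card {..<?n}) * (\<alpha> j / ?n)"
      using assms that by (simp add: \<Lambda>_def)
    finally obtain g where "(\<Sum>k<?n. rank_one (g k)) = (\<Sum>k<?n. rank_one (?r (e k)))"
      "\<forall>k\<in>{..<?n}. (norm (g k))\<^sup>2 = \<alpha> j / ?n"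
      using equalize_norms[of "{..<?n}" "\<lambda>k. ?r (e k)" "\<alpha> j / ?n"] by auto
    moreover have "(\<Sum>k<?n. rank_one (?r (e k))) = ctranspose (F j) ** F j"
      unfolding ctranspose_mult_self_rows
      by (rule sum.reindex_bij_betw[OF e, of "\<lambda>k. rank_one (?r k)"])
    ultimately show ?thesis by (intro exI[of _ g]) auto
  qed
  then obtain g where g: "ctranspose (F j) ** F j = (\<Sum>k<?n. rank_one (g j k))"
      "k < ?n \<Longrightarrow> (norm (g j k))\<^sup>2 = \<alpha> j / ?n" if "j \<in> {1..m}" for j k
    by metis
  define G where "G i = g ((i - 1) div ?n + 1) ((i - 1) mod ?n)" for i
  have G: "G ((j - 1) * ?n + k + 1) = g j k" if "j \<in> {1..m}" "k < ?n" for j k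
    using that by (simp add: G_def)
  have "G \<in> \<B> (?n * m) (block_weights ?n \<alpha>)"
    unfolding \<B>_def mem_Collect_eq
  proof
    fix i assume "i \<in> {1..?n * m}"
    then obtain j k where jk: "j \<in> {1..m}" "k < ?n" "i = (j - 1) * ?n + k + 1"
      by (rule block_index_cases)
    then show "(norm (G i))\<^sup>2 = block_weights ?n \<alpha> i"
      using G[OF jk(1,2)] g(2)[OF jk(1,2)] block_weights_block[OF jk(2), of j \<alpha>] by simp
  qed
  moreover have "frame_operator (?n * m) G = G_frame_operator m F"
    unfolding frame_operator_def G_frame_operator_def sum_blocks
    using G g(1) by (intro sum.cong) auto
  ultimately show ?thesis by blast
qed

text \<open>In this direction the vectors of block \<open>j\<close>, conjugated, simply become the
  rows of one operator; their \<open>n\<close> equal squared norms add up to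
  \<open>\<alpha> j\<close>.\<close>

lemma frame_operator_eq_G_frame_operator:
  fixes G :: "nat \<Rightarrow> complex^'d"
  assumes "G \<in> \<B> (CARD('n) * m) (block_weights CARD('n) \<alpha>)"
  shows "\<exists>F\<in>(\<Lambda> m \<alpha> :: (nat \<Rightarrow> complex^'d^'n) set).
           G_frame_operator m F = frame_operator (CARD('n) * m) G"
proof -
  let ?n = "CARD('n)"
  obtain e where e: "bij_betw e (UNIV :: 'n set) {..<?n}"
    using ex_bij_betw_finite_nat[of "UNIV :: 'n set"] by (auto simp: lessThan_atLeast0)
  define F :: "nat \<Rightarrow> complex^'d^'n"
    where "F j = (\<chi> k a. cnj (G ((j - 1) * ?n + e k + 1) $ a))" for j
  have row: "(\<chi> a. cnj (F j $ k $ a)) = G ((j - 1) * ?n + e k + 1)" for j k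
    by (simp add: F_def vec_eq_iff)
  have weight: "(norm (G ((j - 1) * ?n + k + 1)))\<^sup>2 = \<alpha> j / ?n" if "j \<in> {1..m}" "k < ?n" for j k
  proof -
    \<comment> \<open>The position has to lie in \<open>{1..?n * m}\<close>, the only range on which
      \<open>\<B>\<close> fixes norms.\<close>
    have "(j - 1) * ?n + k + 1 \<le> (j - 1) * ?n + ?n"
      using that by simp
    also have "\<dots> = j * ?n"
      using that by (simp add: algebra_simps)
    also have "\<dots> \<le> ?n * m"
      using that by simp
    finally show ?thesis
      using assms block_weights_block[OF that(2), of j \<alpha>] that(1) by (simp add: \<B>_def)
  qed
  have "(frob_norm (F j))\<^sup>2 = \<alpha> j" if "j \<in> {1..m}" for j
  proof -
    have "(frob_norm (F j))\<^sup>2 = (\<Sum>k<?n. (norm (G ((j - 1) * ?n + k + 1)))\<^sup>2)"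
      unfolding frob_norm_rows row
      by (rule sum.reindex_bij_betw[OF e, of "\<lambda>k. (norm (G ((j - 1) * ?n + k + 1)))\<^sup>2"])
    also have "\<dots> = (\<Sum>k<?n. \<alpha> j / ?n)"
      using weight[OF that] by (intro sum.cong) auto
    finally show ?thesis by simp
  qed
  then have "F \<in> \<Lambda> m \<alpha>"
    by (simp add: \<Lambda>_def G_bessel)
  moreover have "G_frame_operator m F = frame_operator (?n * m) G"
    unfolding frame_operator_def G_frame_operator_def sum_blocks ctranspose_mult_self_rows row
    by (intro sum.cong refl sum.reindex_bij_betw[OF e, of "\<lambda>k. rank_one (G ((_ - 1) * ?n + k + 1))"])
  ultimately show ?thesis by blast
qed

text \<open>Both distances depend on a family only through its frame operator, so this equality
  makes the two problems one.\<close>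

lemma G_frame_operators_eq_frame_operators:
  "G_frame_operator m ` (\<Lambda> m \<alpha> :: (nat \<Rightarrow> complex^'d^'n) set)
     = frame_operator (CARD('n) * m) ` \<B> (CARD('n) * m) (block_weights CARD('n) \<alpha>)"
proof (intro subset_antisym image_subsetI)
  fix F :: "nat \<Rightarrow> complex^'d^'n" assume "F \<in> \<Lambda> m \<alpha>"
  then show "G_frame_operator m F
      \<in> frame_operator (CARD('n) * m) ` \<B> (CARD('n) * m) (block_weights CARD('n) \<alpha>)"
    using G_frame_operator_eq_frame_operator[of F m \<alpha>] unfolding image_iff by metis
next
  fix G :: "nat \<Rightarrow> complex^'d" assume "G \<in> \<B> (CARD('n) * m) (block_weights CARD('n) \<alpha>)"
  then show "frame_operator (CARD('n) * m) G
      \<in> G_frame_operator m ` (\<Lambda> m \<alpha> :: (nat \<Rightarrow> complex^'d^'n) set)"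
    using frame_operator_eq_G_frame_operator[of G m \<alpha>] unfolding image_iff by metis
qed

section \<open>Compactness and existence of minimizers\<close>

lemma frame_operator_Suc: "frame_operator (Suc N) g = frame_operator N g + rank_one (g (Suc N))"
  by (simp add: frame_operator_def)

text \<open>Each further vector adds, as a Minkowski sum, the continuous image of a sphere. Working
  with the operators avoids a topology on families, whose values beyond \<open>N\<close> are
  arbitrary.\<close>

lemma compact_frame_operators:
  assumes "\<And>i. i \<in> {1..N} \<Longrightarrow> 0 \<le> w i"
  shows "compact (frame_operator N ` (\<B> N w :: (nat \<Rightarrow> complex^'d) set))"
  using assms
proof (induction N)
  case 0
  then show ?case by (simp add: frame_operator_def image_constant_conv)
next
  case (Suc N)
  let ?S = "sphere 0 (sqrt (w (Suc N))) :: (complex^'d) set"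
  \<comment> \<open>Nonnegativity of the weight makes its square root a genuine radius.\<close>
  have S: "x \<in> ?S \<longleftrightarrow> (norm x)\<^sup>2 = w (Suc N)" for x :: "complex^'d"
    using Suc.prems[of "Suc N"] by (auto simp: real_sqrt_unique)
  have "continuous_on ?S (\<lambda>g. (\<chi> a b. g $ a * cnj (g $ b)) :: complex^'d^'d)"
    by (intro continuous_intros)
  then have "continuous_on ?S rank_one"
    by (rule continuous_on_eq) (simp add: vec_eq_iff rank_one_nth)
  then have "compact (rank_one ` ?S)"
    by (rule compact_continuous_image) simp
  then have "compact {a + b | a b. a \<in> frame_operator N ` \<B> N w \<and> b \<in> rank_one ` ?S}"
    using Suc by (intro compact_sums) auto
  also have "{a + b | a b. a \<in> frame_operator N ` \<B> N w \<and> b \<in> rank_one ` ?S}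
      = frame_operator (Suc N) ` \<B> (Suc N) w"
  proof (intro subset_antisym subsetI)
    fix s assume "s \<in> {a + b | a b. a \<in> frame_operator N ` \<B> N w \<and> b \<in> rank_one ` ?S}"
    then obtain g x where g: "g \<in> \<B> N w" "x \<in> ?S" "s = frame_operator N g + rank_one x"
      by blast
    \<comment> \<open>The update lies outside the range of summation, so the last vector is free to
      choose.\<close>
    have "frame_operator N (g(Suc N := x)) = frame_operator N g"
      unfolding frame_operator_def by (intro sum.cong) auto
    then have "s = frame_operator (Suc N) (g(Suc N := x))"
      by (simp add: frame_operator_Suc g)
    moreover have "g(Suc N := x) \<in> \<B> (Suc N) w"
      using g(1) g(2)[unfolded S] by (auto simp: \<B>_def)
    ultimately show "s \<in> frame_operator (Suc N) ` \<B> (Suc N) w"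
      by blast
  next
    fix s assume "s \<in> frame_operator (Suc N) ` (\<B> (Suc N) w :: (nat \<Rightarrow> complex^'d) set)"
    then obtain g :: "nat \<Rightarrow> complex^'d"
      where g: "g \<in> \<B> (Suc N) w" "s = frame_operator N g + rank_one (g (Suc N))"
      by (auto simp: frame_operator_Suc)
    moreover have "g \<in> \<B> N w" "g (Suc N) \<in> ?S"
      using g unfolding S by (auto simp: \<B>_def)
    ultimately show "s \<in> {a + b | a b. a \<in> frame_operator N ` \<B> N w \<and> b \<in> rank_one ` ?S}"
      by blast
  qed
  finally show ?case .
qed

lemma \<B>_nonempty:
  assumes "\<And>i. i \<in> {1..N} \<Longrightarrow> 0 \<le> w i"
  shows "\<B> N w \<noteq> ({} :: (nat \<Rightarrow> complex^'d) set)"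
proof -
  \<comment> \<open>The absolute value allows a choice at every index, also outside
    \<open>{1..N}\<close>, where \<open>w\<close> may be negative.\<close>
  have "\<exists>x :: complex^'d. norm x = sqrt \<bar>w i\<bar>" for i
    by (rule vector_choose_size[of "sqrt \<bar>w i\<bar>"]) auto
  then obtain g :: "nat \<Rightarrow> complex^'d" where "norm (g i) = sqrt \<bar>w i\<bar>" for i
    by metis
  then have "g \<in> \<B> N w"
    using assms by (auto simp: \<B>_def)
  then show ?thesis by blast
qed

lemma frame_operator_attains_min:
  assumes "\<And>i. i \<in> {1..N} \<Longrightarrow> 0 \<le> w i"
  shows "\<exists>Gop\<in>\<B> N w. \<forall>G\<in>\<B> N w.
    frob_norm (A - frame_operator N Gop) \<le> frob_norm (A - frame_operator N G)"
proof -
  let ?K = "frame_operator N ` \<B> N w"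
  have "continuous_on ?K (\<lambda>S. norm (A - S))"
    by (intro continuous_intros)
  then have "\<exists>S\<in>?K. \<forall>S'\<in>?K. norm (A - S) \<le> norm (A - S')"
    using compact_frame_operators[of N w] \<B>_nonempty[of N w] assms
    by (intro continuous_attains_inf) auto
  then show ?thesis
    by (simp add: frob_norm_eq_norm)
qed

subsection \<open>Diagonalization of Hermitian matrices\<close>

text \<open>With this order of the factors the condition says that the rows of \<open>U\<close> are
  orthonormal.\<close>

definition unitary_matrix :: "complex^'d^'d \<Rightarrow> bool" where
  "unitary_matrix U \<longleftrightarrow> U ** ctranspose U = mat 1"

lemma unitary_matrix_left: "unitary_matrix U \<Longrightarrow> ctranspose U ** U = mat 1"
  using matrix_left_right_inverse by (auto simp: unitary_matrix_def)

lemma unitary_matrix_ctranspose: "unitary_matrix U \<Longrightarrow> unitary_matrix (ctranspose U)"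
  using unitary_matrix_left by (simp add: unitary_matrix_def)

lemma unitary_matrix_mult: "unitary_matrix U \<Longrightarrow> unitary_matrix V \<Longrightarrow> unitary_matrix (U ** V)"
  unfolding unitary_matrix_def ctranspose_mult
  by (metis matrix_mul_assoc matrix_mul_lid)

lemma hinner_add_left: "hinner (x + y) z = hinner x z + hinner y z"
  by (simp add: hinner_def distrib_right sum.distrib)

lemma hinner_add_right: "hinner z (x + y) = hinner z x + hinner z y"
  by (simp add: hinner_def distrib_left sum.distrib)

lemma hinner_scale_left: "hinner (c *s x) y = c * hinner x y"
  by (simp add: hinner_def sum_distrib_left mult.assoc)

lemma hinner_scale_right: "hinner x (c *s y) = cnj c * hinner x y"
  by (simp add: hinner_def sum_distrib_left mult_ac)

lemma vector_add_matrix: "(x + y) v* A = x v* A + y v* A"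
  for A :: "'a::semiring_1^'n^'m"
  by (simp add: vector_matrix_mult_def vec_eq_iff distrib_right sum.distrib)

lemma vector_scale_matrix: "(c *s x) v* A = c *s (x v* A)"
  for A :: "'a::comm_semiring_1^'n^'m"
  by (simp add: vector_matrix_mult_def vec_eq_iff sum_distrib_left mult_ac)

lemmas hinner_bilinear = hinner_add_left hinner_add_right hinner_scale_left hinner_scale_right
  vector_add_matrix vector_scale_matrix

lemma unitary_matrix_iff_rows:
  "unitary_matrix W \<longleftrightarrow> (\<forall>k l. hinner (W $ k) (W $ l) = (if k = l then 1 else 0))"
  by (simp add: unitary_matrix_def vec_eq_iff mat_def matrix_matrix_mult_def ctranspose_def hinner_def)

text \<open>Conjugation by \<open>W\<close> evaluates the sesquilinear form of \<open>A\<close> on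
  the rows of \<open>W\<close>, so replacing rows of \<open>W\<close> changes only the entries in
  those rows and columns.\<close>

lemma conjugate_nth:
  "(W ** A ** ctranspose W) $ k $ l = hinner (W $ k v* A) (W $ l)"
  by (simp add: matrix_matrix_mult_def vector_matrix_mult_def ctranspose_def hinner_def mult.commute)

lemma hermitian_form_commute:
  assumes "ctranspose A = A"
  shows "hinner (y v* A) x = cnj (hinner (x v* A) y)"
proof -
  have A: "cnj (A $ i $ j) = A $ j $ i" for i j
    using assms by (auto simp: ctranspose_def vec_eq_iff)
  have "cnj (hinner (x v* A) y) = (\<Sum>i\<in>UNIV. \<Sum>j\<in>UNIV. A $ i $ j * cnj (x $ j) * y $ i)"
    by (simp add: hinner_def vector_matrix_mult_def sum_distrib_right sum_distrib_left A mult_ac)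
  also have "\<dots> = (\<Sum>j\<in>UNIV. \<Sum>i\<in>UNIV. A $ i $ j * cnj (x $ j) * y $ i)"
    by (rule sum.swap)
  also have "\<dots> = hinner (y v* A) x"
    by (simp add: hinner_def vector_matrix_mult_def sum_distrib_right sum_distrib_left mult_ac)
  finally show ?thesis by simp
qed

text \<open>The orthonormality relations are closed conditions, and every unitary matrix has
  Frobenius norm \<open>sqrt d\<close>.\<close>

lemma compact_unitary_matrices: "compact {W :: complex^'d^'d. unitary_matrix W}"
proof -
  have "closed {W :: complex^'d^'d. \<forall>k l. hinner (W $ k) (W $ l) = (if k = l then 1 else 0)}"
    unfolding hinner_def
    by (intro closed_Collect_all closed_Collect_eq continuous_intros)
  then have "closed {W :: complex^'d^'d. unitary_matrix W}"
    by (simp add: unitary_matrix_iff_rows)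
  moreover have "norm W \<le> sqrt (real CARD('d))" if "unitary_matrix W" for W :: "complex^'d^'d"
    using unitary_matrix_left[OF that]
    by (simp add: frob_norm_eq_norm[symmetric] frob_norm_def trace_def mat_def)
  then have "bounded {W :: complex^'d^'d. unitary_matrix W}"
    unfolding bounded_iff by blast
  ultimately show ?thesis
    by (simp add: compact_eq_bounded_closed)
qed

text \<open>The rotation that diagonalizes the real symmetric matrix with diagonal
  \<open>p, q\<close> and off-diagonal entry \<open>r\<close>: the trace stays fixed while the
  squared diagonal sum grows by \<open>2 * r\<^sup>2\<close>.\<close>

lemma jacobi_rotation:
  fixes p q r :: real
  assumes "r \<noteq> 0"
  obtains c s where "c\<^sup>2 + s\<^sup>2 = 1"
    "p\<^sup>2 + q\<^sup>2 < (c\<^sup>2 * p + s\<^sup>2 * q + 2 * c * s * r)\<^sup>2 + (s\<^sup>2 * p + c\<^sup>2 * q - 2 * c * s * r)\<^sup>2"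
proof -
  \<comment> \<open>\<open>M\<close> is the gap between the two eigenvalues of that matrix.\<close>
  define M where "M = sqrt ((p - q)\<^sup>2 + (2 * r)\<^sup>2)"
  have pos: "0 < (p - q)\<^sup>2 + (2 * r)\<^sup>2"
    using assms by (intro add_nonneg_pos) auto
  have M: "M\<^sup>2 = (p - q)\<^sup>2 + (2 * r)\<^sup>2" "M \<noteq> 0"
    using real_sqrt_pow2[OF less_imp_le[OF pos]] real_sqrt_gt_zero[OF pos]
    unfolding M_def by linarith+
  have "((p - q) / M)\<^sup>2 + (2 * r / M)\<^sup>2 = 1"
    using M(2) by (simp only: power_divide add_divide_distrib[symmetric] M(1)[symmetric]) simp
  then obtain t where t: "(p - q) / M = cos t" "2 * r / M = sin t"
    using sincos_total_2pi by metis
  \<comment> \<open>Half the angle, because the new diagonal involves \<open>c\<close> and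
    \<open>s\<close> only through \<open>c\<^sup>2\<close>, \<open>s\<^sup>2\<close> and
    \<open>2 * c * s\<close>.\<close>
  define c s where "c = cos (t / 2)" and "s = sin (t / 2)"
  have cs: "c\<^sup>2 + s\<^sup>2 = 1" "c\<^sup>2 - s\<^sup>2 = cos t" "2 * c * s = sin t"
    using cos_double[of "t / 2"] sin_double[of "t / 2"] by (auto simp: c_def s_def)
  define p' q' where "p' = c\<^sup>2 * p + s\<^sup>2 * q + 2 * c * s * r"
    and "q' = s\<^sup>2 * p + c\<^sup>2 * q - 2 * c * s * r"
  have "p' + q' = (c\<^sup>2 + s\<^sup>2) * (p + q)"
    by (simp add: p'_def q'_def algebra_simps)
  then have add: "p' + q' = p + q" by (simp add: cs)
  have "p' - q' = (c\<^sup>2 - s\<^sup>2) * (p - q) + 2 * c * s * (2 * r)"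
    by (simp add: p'_def q'_def algebra_simps)
  also have "\<dots> = ((p - q)\<^sup>2 + (2 * r)\<^sup>2) / M"
    unfolding cs(2,3) t[symmetric] by (simp add: power2_eq_square add_divide_distrib)
  also have "\<dots> = M"
    using M(2) by (simp only: M(1)[symmetric]) (simp add: power2_eq_square)
  finally have diff: "p' - q' = M" .
  have "2 * (p'\<^sup>2 + q'\<^sup>2) = (p' + q')\<^sup>2 + (p' - q')\<^sup>2"
    by (simp add: power2_eq_square algebra_simps)
  also have "\<dots> = 2 * (p\<^sup>2 + q\<^sup>2) + (2 * r)\<^sup>2"
    unfolding add diff M(1) by (simp add: power2_eq_square algebra_simps)
  finally have "p'\<^sup>2 + q'\<^sup>2 = p\<^sup>2 + q\<^sup>2 + 2 * r\<^sup>2"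
    by simp
  moreover have "0 < r\<^sup>2"
    using assms by simp
  ultimately have "p\<^sup>2 + q\<^sup>2 < p'\<^sup>2 + q'\<^sup>2"
    by linarith
  then show ?thesis
    using that cs(1) by (simp add: p'_def q'_def)
qed

text \<open>
  Jacobi's method by compactness: a unitary conjugate of \<open>A\<close> whose diagonal has maximal square sum
  has no nonzero off-diagonal entry, since a plane rotation would increase that sum.
\<close>

lemma hermitian_diagonalizable:
  fixes A :: "complex^'d^'d"
  assumes herm: "ctranspose A = A"
  obtains W where "unitary_matrix W" "\<And>k l. k \<noteq> l \<Longrightarrow> (W ** A ** ctranspose W) $ k $ l = 0"
proof -
  define h where "h x y = hinner (x v* A) y" for x y
  define f where "f W = (\<Sum>k\<in>UNIV. (Re (h (W $ k) (W $ k)))\<^sup>2)" for W :: "complex^'d^'d"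
  have "continuous_on {W. unitary_matrix W} f"
    unfolding f_def h_def hinner_def vector_matrix_mult_def vec_lambda_beta
    by (intro continuous_intros)
  moreover have "unitary_matrix (mat 1)"
    by (simp add: unitary_matrix_iff_rows hinner_def mat_def if_distrib[of cnj]
        if_distrib[of "\<lambda>x. x * _"] cong: if_cong)
  then have "{W :: complex^'d^'d. unitary_matrix W} \<noteq> {}" by blast
  ultimately obtain W where W: "unitary_matrix W" "\<And>V. unitary_matrix V \<Longrightarrow> f V \<le> f W"
    using continuous_attains_sup[OF compact_unitary_matrices, of f] by auto
  have "h (W $ i) (W $ j) = 0" if "i \<noteq> j" for i j
  proof (rule ccontr)
    assume nz: "h (W $ i) (W $ j) \<noteq> 0"
    define r where "r = cmod (h (W $ i) (W $ j))"
    \<comment> \<open>The phase of the off-diagonal entry. Multiplying row \<open>j\<close> by it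
      turns both cross terms into the positive real \<open>r\<close> and leaves the diagonal entry
      at \<open>j\<close> unchanged, so a real rotation suffices.\<close>
    define u where "u = h (W $ i) (W $ j) / complex_of_real r"
    have "r \<noteq> 0" using nz by (simp add: r_def)
    have "cmod u = 1"
      using \<open>r \<noteq> 0\<close> by (simp add: u_def norm_divide) (simp add: r_def)
    then have uu: "cnj u * u = 1" "u * cnj u = 1"
      by (metis complex_norm_square mult.commute of_real_1 one_power2)+
    define x y where "x = W $ i" and "y = u *s (W $ j)"
    have W_rows: "hinner (W $ k) (W $ l) = (if k = l then 1 else 0)" for k l
      using W(1) by (simp add: unitary_matrix_iff_rows)
    have "h (W $ i) (W $ j) = u * complex_of_real r"
      using \<open>r \<noteq> 0\<close> by (simp add: u_def)
    then have hxy: "h x y = complex_of_real r"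
      using uu by (simp add: x_def y_def h_def hinner_bilinear flip: mult.assoc)
    have hyx: "h y x = complex_of_real r"
      using hermitian_form_commute[OF herm, of y x] hxy by (simp add: h_def)
    have hyy: "h y y = h (W $ j) (W $ j)"
      using uu by (simp add: y_def h_def hinner_bilinear flip: mult.assoc)
    obtain c s where cs: "c\<^sup>2 + s\<^sup>2 = 1"
      "(Re (h x x))\<^sup>2 + (Re (h y y))\<^sup>2
         < (c\<^sup>2 * Re (h x x) + s\<^sup>2 * Re (h y y) + 2 * c * s * r)\<^sup>2
           + (s\<^sup>2 * Re (h x x) + c\<^sup>2 * Re (h y y) - 2 * c * s * r)\<^sup>2"
      using jacobi_rotation[OF \<open>r \<noteq> 0\<close>] by metis
    define x' y' where "x' = complex_of_real c *s x + complex_of_real s *s y"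
      and "y' = complex_of_real (- s) *s x + complex_of_real c *s y"
    define V where "V = (\<chi> k. if k = i then x' else if k = j then y' else W $ k)"
    have V: "V $ i = x'" "V $ j = y'" "\<And>k. k \<noteq> i \<Longrightarrow> k \<noteq> j \<Longrightarrow> V $ k = W $ k"
      using that by (auto simp: V_def)
    have "Re (h x' x') = c\<^sup>2 * Re (h x x) + s\<^sup>2 * Re (h y y) + 2 * c * s * r"
      using hxy hyx unfolding x'_def h_def hinner_bilinear
      by (simp add: power2_eq_square algebra_simps)
    moreover have "Re (h y' y') = s\<^sup>2 * Re (h x x) + c\<^sup>2 * Re (h y y) - 2 * c * s * r"
      using hxy hyx unfolding y'_def h_def hinner_bilinear
      by (simp add: power2_eq_square algebra_simps)
    ultimately have less: "(Re (h (W $ i) (W $ i)))\<^sup>2 + (Re (h (W $ j) (W $ j)))\<^sup>2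
        < (Re (h x' x'))\<^sup>2 + (Re (h y' y'))\<^sup>2"
      using cs(2) hyy by (simp add: x_def)
    have split: "sum F UNIV = F i + F j + sum F (UNIV - {i, j})" for F :: "'d \<Rightarrow> real"
      using sum.subset_diff[of "{i, j}" UNIV F] that by (simp add: add.commute)
    have "(\<Sum>k\<in>UNIV - {i, j}. (Re (h (V $ k) (V $ k)))\<^sup>2)
        = (\<Sum>k\<in>UNIV - {i, j}. (Re (h (W $ k) (W $ k)))\<^sup>2)"
      by (intro sum.cong) (auto simp: V(3))
    then have "f W < f V"
      using less by (simp add: f_def split V(1,2))
    moreover have "unitary_matrix V"
    \<comment> \<open>\<open>x'\<close> and \<open>y'\<close> are an orthonormal pair in the span of
      rows \<open>i\<close> and \<open>j\<close>, hence still orthogonal to the remaining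
      rows.\<close>
    proof -
      have cs': "complex_of_real c * complex_of_real c + complex_of_real s * complex_of_real s = 1"
        using cs(1) by (metis of_real_1 of_real_add of_real_mult power2_eq_square)
      have xy: "hinner x x = 1" "hinner y y = 1" "hinner x y = 0" "hinner y x = 0"
        using that uu by (simp_all add: x_def y_def hinner_bilinear W_rows)
      have xy': "hinner x' x' = 1" "hinner y' y' = 1" "hinner x' y' = 0" "hinner y' x' = 0"
        using cs' unfolding x'_def y'_def hinner_bilinear xy by (simp_all add: algebra_simps)
      have rest: "hinner x' (W $ k) = 0" "hinner y' (W $ k) = 0"
        "hinner (W $ k) x' = 0" "hinner (W $ k) y' = 0" if "k \<noteq> i" "k \<noteq> j" for k
        using that unfolding x'_def y'_def x_def y_def hinner_bilinear by (auto simp: W_rows)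
      show ?thesis
        unfolding unitary_matrix_iff_rows V_def using xy' rest that by (auto simp: W_rows)
    qed
    ultimately show False
      using W(2)[of V] by simp
  qed
  then show ?thesis
    using that W(1) by (simp add: conjugate_nth h_def)
qed

section \<open>Characteristic polynomials and unitary equivalence\<close>

lemma map_matrix_const_poly_mult:
  fixes S T :: "complex^'d^'d"
  shows "(\<chi> i j. [:(S ** T) $ i $ j:]) = (\<chi> i j. [:S $ i $ j:]) ** (\<chi> i j. [:T $ i $ j:])"
proof -
  have "[:sum f I:] = (\<Sum>i\<in>I. [:f i:])" for f :: "'d \<Rightarrow> complex" and I
    by (rule poly_eqI) (simp add: coeff_sum coeff_pCons split: nat.split)
  then show ?thesis
    by (simp add: matrix_matrix_mult_def vec_eq_iff mult.commute)
qed

text \<open>Over the polynomial ring the scalar matrix \<open>?X\<close> commutes with everything,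
  so the conjugation can be pulled out of the determinant, where its two factors multiply to
  1.\<close>

lemma charpoly_unitary_conjugate:
  assumes "unitary_matrix W"
  shows "charpoly (W ** A ** ctranspose W) = charpoly A"
proof -
  let ?C = "\<lambda>M :: complex^'d^'d. (\<chi> i j. [:M $ i $ j:]) :: complex poly^'d^'d"
  let ?X = "mat [:0, 1:] :: complex poly^'d^'d"
  have char: "charpoly M = det (?X - ?C M)" for M
    unfolding charpoly_def by (rule arg_cong[of _ _ det]) (simp add: vec_eq_iff mat_def)
  have C: "?C (S ** T) = ?C S ** ?C T" for S T
    by (rule map_matrix_const_poly_mult)
  have one: "?C W ** ?C (ctranspose W) = mat 1"
    using assms by (simp add: C[symmetric] unitary_matrix_def) (simp add: vec_eq_iff mat_def)
  have X_mult: "M ** ?X = ?X ** M" for M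
    by (simp add: vec_eq_iff mat_def matrix_matrix_mult_def if_distrib[of "\<lambda>x. x * _"]
        if_distrib[of "\<lambda>x. _ * x"] mult.commute cong: if_cong)
  have "?C W ** (?X - ?C A) ** ?C (ctranspose W)
      = ?C W ** ?X ** ?C (ctranspose W) - ?C W ** ?C A ** ?C (ctranspose W)"
    by (simp add: matrix_sub_ldistrib matrix_sub_rdistrib)
  also have "\<dots> = ?X - ?C (W ** A ** ctranspose W)"
    using one by (simp add: X_mult C flip: matrix_mul_assoc)
  finally have "charpoly (W ** A ** ctranspose W)
      = det (?C W) * det (?X - ?C A) * det (?C (ctranspose W))"
    by (simp add: char flip: det_mul)
  also have "\<dots> = det (?C W ** ?C (ctranspose W)) * det (?X - ?C A)"
    by (simp add: det_mul mult_ac)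
  finally show ?thesis
    by (simp add: one char)
qed

lemma spectrum_diagonal:
  fixes D :: "complex^'d^'d"
  assumes "\<And>k l. k \<noteq> l \<Longrightarrow> D $ k $ l = 0"
  shows "spectrum D = image_mset (\<lambda>k. D $ k $ k) (mset_set UNIV)"
proof -
  have "charpoly D = (\<Prod>k\<in>UNIV. [:- (D $ k $ k), 1:])"
    unfolding charpoly_def using assms by (subst det_diagonal) auto
  moreover have "proots (\<Prod>k\<in>UNIV. [:- (D $ k $ k), 1:]) = (\<Sum>k\<in>UNIV. {#D $ k $ k#})"
    by (subst proots_prod) auto
  ultimately show ?thesis
    by (simp add: spectrum_def sum_unfold_sum_mset)
qed

text \<open>Diagonalize both matrices. Equal spectra mean that the two diagonals agree up to a
  permutation, which a reordering of rows absorbs.\<close>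

lemma hermitian_unitary_equivalent:
  fixes A A' :: "complex^'d^'d"
  assumes "ctranspose A = A" "ctranspose A' = A'" "spectrum A' = spectrum A"
  obtains U where "unitary_matrix U" "A' = U ** A ** ctranspose U"
proof -
  obtain W where W: "unitary_matrix W" "\<And>k l. k \<noteq> l \<Longrightarrow> (W ** A ** ctranspose W) $ k $ l = 0"
    using hermitian_diagonalizable[OF assms(1)] by blast
  obtain V where V: "unitary_matrix V" "\<And>k l. k \<noteq> l \<Longrightarrow> (V ** A' ** ctranspose V) $ k $ l = 0"
    using hermitian_diagonalizable[OF assms(2)] by blast
  define D where "D = W ** A ** ctranspose W"
  define D' where "D' = V ** A' ** ctranspose V"
  have "spectrum D' = spectrum D"
    using assms(3) by (simp add: D_def D'_def spectrum_def charpoly_unitary_conjugate W(1) V(1))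
  then have "image_mset (\<lambda>k. D $ k $ k) (mset_set UNIV) = image_mset (\<lambda>k. D' $ k $ k) (mset_set UNIV)"
    using spectrum_diagonal[of D] spectrum_diagonal[of D'] W(2) V(2) by (simp add: D_def D'_def)
  then obtain \<pi> where \<pi>: "\<pi> permutes UNIV" "\<And>k. D $ k $ k = D' $ \<pi> k $ \<pi> k"
    using image_mset_eq_implies_permutes[of UNIV "\<lambda>k. D $ k $ k" "\<lambda>k. D' $ k $ k"] by auto
  have inj: "\<pi> k = \<pi> l \<longleftrightarrow> k = l" for k l
    using permutes_inj[OF \<pi>(1)] by (auto dest: injD)
  \<comment> \<open>Permuting orthonormal rows keeps them orthonormal and permutes the diagonal of
    the conjugate.\<close>
  define V' where "V' = (\<chi> k. V $ \<pi> k)"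
  have V': "unitary_matrix V'"
    using V(1) by (simp add: unitary_matrix_iff_rows V'_def inj)
  have "(V' ** A' ** ctranspose V') $ k $ l = D $ k $ l" for k l
  proof -
    have "(V' ** A' ** ctranspose V') $ k $ l = D' $ \<pi> k $ \<pi> l"
      by (simp add: conjugate_nth V'_def D'_def)
    also have "\<dots> = D $ k $ l"
      using \<pi>(2) W(2)[of k l] V(2)[of "\<pi> k" "\<pi> l"] inj by (cases "k = l") (auto simp: D_def D'_def)
    finally show ?thesis .
  qed
  then have eq: "V' ** A' ** ctranspose V' = W ** A ** ctranspose W"
    by (simp add: vec_eq_iff D_def)
  have "A' = ctranspose V' ** (V' ** A' ** ctranspose V') ** V'"
    using unitary_matrix_left[OF V'] by (metis matrix_mul_assoc matrix_mul_lid matrix_mul_rid)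
  also have "\<dots> = (ctranspose V' ** W) ** A ** ctranspose (ctranspose V' ** W)"
    unfolding eq by (simp add: ctranspose_mult matrix_mul_assoc)
  finally show ?thesis
    using that unitary_matrix_mult[OF unitary_matrix_ctranspose[OF V'] W(1)] by blast
qed

section \<open>Unitary invariance of the distances\<close>

lemma frob_norm_mult_unitary_left:
  assumes "unitary_matrix U"
  shows "frob_norm (U ** T) = frob_norm T"
proof -
  have "ctranspose (U ** T) ** (U ** T) = ctranspose T ** (ctranspose U ** U) ** T"
    by (simp add: ctranspose_mult matrix_mul_assoc)
  then show ?thesis
    by (simp add: frob_norm_def unitary_matrix_left[OF assms])
qed

text \<open>Cyclicity of the trace brings \<open>ctranspose U\<close> and \<open>U\<close>
  together.\<close>

lemma frob_norm_mult_unitary_right: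
  assumes "unitary_matrix U"
  shows "frob_norm (T ** ctranspose U) = frob_norm T"
proof -
  have "trace (ctranspose (T ** ctranspose U) ** (T ** ctranspose U))
      = trace (U ** (ctranspose T ** T ** ctranspose U))"
    by (simp add: ctranspose_mult matrix_mul_assoc)
  also have "\<dots> = trace (ctranspose T ** T ** (ctranspose U ** U))"
    by (subst trace_mul_sym) (simp add: matrix_mul_assoc)
  finally show ?thesis
    by (simp add: frob_norm_def unitary_matrix_left[OF assms])
qed

lemma G_frame_operator_mult_right:
  "G_frame_operator m (\<lambda>i. F i ** ctranspose U) = U ** G_frame_operator m F ** ctranspose U"
  unfolding G_frame_operator_def
  by (induction m)
    (simp_all add: ctranspose_mult matrix_mul_assoc matrix_add_ldistrib matrix_add_rdistrib)

text \<open>Composing every \<open>F i\<close> with \<open>ctranspose U\<close> stays in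
  \<open>\<Lambda>\<close>, conjugates the frame operator by \<open>U\<close> and so realizes the
  same distance for the conjugated target.\<close>

lemma distances_subset_unitary_conjugate:
  fixes A :: "complex^'d^'d"
  assumes "unitary_matrix U"
  shows "(\<lambda>F. frob_norm (A - G_frame_operator m F)) ` (\<Lambda> m \<alpha> :: (nat \<Rightarrow> complex^'d^'n) set)
    \<subseteq> (\<lambda>F. frob_norm (U ** A ** ctranspose U - G_frame_operator m F)) ` (\<Lambda> m \<alpha> :: (nat \<Rightarrow> complex^'d^'n) set)"
proof (rule image_subsetI)
  fix F :: "nat \<Rightarrow> complex^'d^'n" assume F: "F \<in> \<Lambda> m \<alpha>"
  let ?F = "\<lambda>i. F i ** ctranspose U"
  have "U ** A ** ctranspose U - G_frame_operator m ?F
      = U ** (A - G_frame_operator m F) ** ctranspose U"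
    by (simp add: G_frame_operator_mult_right matrix_sub_ldistrib matrix_sub_rdistrib)
  then have "frob_norm (A - G_frame_operator m F)
      = frob_norm (U ** A ** ctranspose U - G_frame_operator m ?F)"
    by (simp add: frob_norm_mult_unitary_left frob_norm_mult_unitary_right assms)
  moreover have "?F \<in> \<Lambda> m \<alpha>"
    using F by (simp add: \<Lambda>_def G_bessel frob_norm_mult_unitary_right assms)
  ultimately show "frob_norm (A - G_frame_operator m F)
      \<in> (\<lambda>F. frob_norm (U ** A ** ctranspose U - G_frame_operator m F)) ` (\<Lambda> m \<alpha> :: (nat \<Rightarrow> complex^'d^'n) set)"
    unfolding image_iff by blast
qed

text \<open>The missing inclusion is the previous one for \<open>ctranspose U\<close>, which
  conjugates back to \<open>A\<close>.\<close>

lemma distances_eq_unitary_conjugate: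
  fixes A :: "complex^'d^'d"
  assumes U: "unitary_matrix U"
  shows "(\<lambda>F. frob_norm (U ** A ** ctranspose U - G_frame_operator m F)) ` (\<Lambda> m \<alpha> :: (nat \<Rightarrow> complex^'d^'n) set)
    = (\<lambda>F. frob_norm (A - G_frame_operator m F)) ` (\<Lambda> m \<alpha> :: (nat \<Rightarrow> complex^'d^'n) set)"
proof (rule subset_antisym)
  have "ctranspose U ** (U ** A ** ctranspose U) ** ctranspose (ctranspose U) = A"
    using unitary_matrix_left[OF U]
    by simp (metis matrix_mul_assoc matrix_mul_lid matrix_mul_rid)
  then show "(\<lambda>F. frob_norm (U ** A ** ctranspose U - G_frame_operator m F)) ` (\<Lambda> m \<alpha> :: (nat \<Rightarrow> complex^'d^'n) set)
      \<subseteq> (\<lambda>F. frob_norm (A - G_frame_operator m F)) ` (\<Lambda> m \<alpha> :: (nat \<Rightarrow> complex^'d^'n) set)"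
    using distances_subset_unitary_conjugate[OF unitary_matrix_ctranspose[OF U], of "U ** A ** ctranspose U" m \<alpha>]
    by simp
qed (rule distances_subset_unitary_conjugate[OF U])

theorem theorem5p2:
  fixes A :: "complex^'d^'d" and m :: nat and \<alpha> :: "nat \<Rightarrow> real"
  defines "\<Lambda>\<^sub>\<alpha> \<equiv> (\<Lambda> m \<alpha> :: (nat \<Rightarrow> complex^'d^'n) set)"
    and "N \<equiv> CARD('n) * m"
    and "w \<equiv> block_weights CARD('n) \<alpha>"
  assumes "m \<ge> 1"
    and "\<And>i. i \<in> {1..m} \<Longrightarrow> \<alpha> i \<ge> 0"
    and "antimono_on {1..m} \<alpha>"
    and "pos_semidef A"
  shows "(\<exists>Fop\<in>\<Lambda>\<^sub>\<alpha>. \<forall>F\<in>\<Lambda>\<^sub>\<alpha>.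
            frob_norm (A - G_frame_operator m Fop) \<le> frob_norm (A - G_frame_operator m F))
       \<and> (\<exists>Gop\<in>\<B> N w. \<forall>G\<in>\<B> N w.
            frob_norm (A - frame_operator N Gop) \<le> frob_norm (A - frame_operator N G))
       \<and> (INF F\<in>\<Lambda>\<^sub>\<alpha>. frob_norm (A - G_frame_operator m F))
           = (INF G\<in>\<B> N w. frob_norm (A - frame_operator N G))
       \<and> (\<forall>A'. pos_semidef A' \<and> spectrum A' = spectrum A \<longrightarrow>
            (INF F\<in>\<Lambda>\<^sub>\<alpha>. frob_norm (A' - G_frame_operator m F))
              = (INF F\<in>\<Lambda>\<^sub>\<alpha>. frob_norm (A - G_frame_operator m F)))
       \<and> (\<forall>F\<in>\<Lambda>\<^sub>\<alpha>.
            is_arg_min (\<lambda>F. frob_norm (A - G_frame_operator m F)) (\<lambda>F. F \<in> \<Lambda>\<^sub>\<alpha>) F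
              \<longleftrightarrow> (\<exists>G. is_arg_min (\<lambda>G. frob_norm (A - frame_operator N G)) (\<lambda>G. G \<in> \<B> N w) G
                       \<and> G_frame_operator m F = frame_operator N G))"
proof -
  let ?S = "G_frame_operator m ` \<Lambda>\<^sub>\<alpha>"
  have S: "?S = frame_operator N ` \<B> N w"
    unfolding \<Lambda>\<^sub>\<alpha>_def N_def w_def by (rule G_frame_operators_eq_frame_operators)
  have dist: "(\<lambda>F. frob_norm (B - G_frame_operator m F)) ` \<Lambda>\<^sub>\<alpha>
      = (\<lambda>G. frob_norm (B - frame_operator N G)) ` \<B> N w" for B
    using arg_cong[OF S, of "image (\<lambda>S. frob_norm (B - S))"] by (simp add: image_image)
  have "0 \<le> w i" if i: "i \<in> {1..N}" for i
  proof -
    obtain j k where jk: "j \<in> {1..m}" "k < CARD('n)" "i = (j - 1) * CARD('n) + k + 1"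
      using i unfolding N_def by (rule block_index_cases)
    then show ?thesis
      using block_weights_block[OF jk(2), of j \<alpha>] assms(5) by (simp add: w_def)
  qed
  then have min_G: "\<exists>Gop\<in>\<B> N w. \<forall>G\<in>\<B> N w.
      frob_norm (A - frame_operator N Gop) \<le> frob_norm (A - frame_operator N G)"
    by (rule frame_operator_attains_min)
  \<comment> \<open>Minimality is carried to the common set of frame operators, and from there to
    \<open>\<Lambda>\<^sub>\<alpha>\<close>.\<close>
  then have "\<exists>s\<in>?S. \<forall>s'\<in>?S. frob_norm (A - s) \<le> frob_norm (A - s')"
    unfolding S by blast
  then have min_F: "\<exists>Fop\<in>\<Lambda>\<^sub>\<alpha>. \<forall>F\<in>\<Lambda>\<^sub>\<alpha>.
      frob_norm (A - G_frame_operator m Fop) \<le> frob_norm (A - G_frame_operator m F)"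
    by blast
  have spec: "(INF F\<in>\<Lambda>\<^sub>\<alpha>. frob_norm (A' - G_frame_operator m F))
      = (INF F\<in>\<Lambda>\<^sub>\<alpha>. frob_norm (A - G_frame_operator m F))"
    if A': "pos_semidef A'" "spectrum A' = spectrum A" for A'
  proof -
    have "ctranspose A = A" "ctranspose A' = A'"
      using A'(1) \<open>pos_semidef A\<close> by (auto simp: pos_semidef_def)
    then obtain U where "unitary_matrix U" "A' = U ** A ** ctranspose U"
      using A'(2) by (rule hermitian_unitary_equivalent)
    then show ?thesis
      unfolding \<Lambda>\<^sub>\<alpha>_def by (simp add: distances_eq_unitary_conjugate)
  qed
  have arg_min: "is_arg_min (\<lambda>F. frob_norm (A - G_frame_operator m F)) (\<lambda>F. F \<in> \<Lambda>\<^sub>\<alpha>) F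
      \<longleftrightarrow> (\<exists>G. is_arg_min (\<lambda>G. frob_norm (A - frame_operator N G)) (\<lambda>G. G \<in> \<B> N w) G
               \<and> G_frame_operator m F = frame_operator N G)" if F: "F \<in> \<Lambda>\<^sub>\<alpha>" for F
  proof -
    have "G_frame_operator m F \<in> frame_operator N ` \<B> N w"
      using F by (simp flip: S)
    then obtain G where G: "G \<in> \<B> N w" "G_frame_operator m F = frame_operator N G"
      by blast
    \<comment> \<open>Both kinds of minimizer are restated as minimality of a frame operator over
      \<open>?S\<close>. Then \<open>G\<close> is the witness from left to right, and equal
      operators give the converse.\<close>
    have F_iff: "is_arg_min (\<lambda>F. frob_norm (A - G_frame_operator m F)) (\<lambda>F. F \<in> \<Lambda>\<^sub>\<alpha>) F
        \<longleftrightarrow> (\<forall>s\<in>?S. frob_norm (A - G_frame_operator m F) \<le> frob_norm (A - s))"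
      using F by (auto simp: is_arg_min_def not_less)
    have G_iff: "is_arg_min (\<lambda>G. frob_norm (A - frame_operator N G)) (\<lambda>G. G \<in> \<B> N w) G'
        \<longleftrightarrow> G' \<in> \<B> N w \<and> (\<forall>s\<in>?S. frob_norm (A - frame_operator N G') \<le> frob_norm (A - s))" for G'
      unfolding S by (auto simp: is_arg_min_def not_less)
    show ?thesis
      unfolding F_iff G_iff using G by auto
  qed
  show ?thesis
    using min_F min_G arg_cong[OF dist, of Inf A] spec arg_min by blast
qed

end
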